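(* Let $S$ be a skew lattice. Then: (i) $S$ is left quasi-normal if and only if for all comparable $\mathcal D$-classes $A>B$ in $S$ and all $x,x'\in B$ such that $x\mathrel{\mathcal R}x'$, one has $x\land A=x'\land A$. (ii) $S$ is right quasi-normal if and only if for all comparable $\mathcal D$-classes $A>B$ in $S$ and all $x,x'\in B$ such that $x\mathrel{\mathcal L}x'$, one has $A\land x=A\land x'$. Dually: (i') $S$ satisfies the identity $a\lor x\lor y=a\lor x\lor a\lor y$ if and only if for all comparable $\mathcal D$-classes $A>B$ in $S$ and all $x,x'\in A$ such that $x\mathrel{\mathcal L}x'$, one has $x\lor B=x'\lor B$. (ii') $S$ satisfies the identity $y\lor x\lor a=y\lor a\lor x\lor a$ if and only if for all comparable $\mathcal D$-classes $A>B$ in $S$ and all $x,x'\in A$ such that $x\mathrel{\mathcal R}x'$, one has $B\lor x=B\lor x'$.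
   Context: A skew lattice is an algebra $(S;\lor,\land)$ where $\land,\lor$ are idempotent associative binary operations satisfying $x\land(x\lor y)=x=(y\lor x)\land x$ and $x\lor(x\land y)=x=(y\land x)\lor x$. Green's relations: $x\mathrel{\mathcal L}y$ iff $x\land y=x$ and $y\land x=y$ (dually $x\lor y=y$ and $y\lor x=x$); $x\mathrel{\mathcal R}y$ iff $x\land y=y$ and $y\land x=x$ (dually $x\lor y=x$ and $y\lor x=y$); $x\mathrel{\mathcal D}y$ iff $x\land y\land x=x$ and $y\land x\land y=y$. $\mathcal D$ is a congruence, $S/\mathcal D$ is a lattice, and for $\mathcal D$-classes $A>B$ means $A>B$ in $S/\mathcal D$. For $\mathcal D$-classes $A>B$, $x\in B$, $u\in A$: $A\land x=\{a\land x:a\in A\}$, $x\land A=\{x\land a:a\in A\}$, $B\lor u=\{b\lor u:b\in B\}$, $u\lor B=\{u\lor b:b\in B\}$. $S$ is right quasi-normal if it satisfies $y\land x\land a=y\land a\land x\land a$, and left quasi-normal if it satisfies $a\land x\land y=a\land x\land a\land y$. *)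

theory Defs
  imports Main
begin

locale skew_lattice =
  meet: semigroup meet + join: semigroup join
  for meet :: "'a \<Rightarrow> 'a \<Rightarrow> 'a" (infixl "\<^bold>\<and>" 70)
  and join :: "'a \<Rightarrow> 'a \<Rightarrow> 'a" (infixl "\<^bold>\<or>" 65) +
  assumes meet_idem: "x \<^bold>\<and> x = x"
    and join_idem: "x \<^bold>\<or> x = x"
    and meet_join_absorb: "x \<^bold>\<and> (x \<^bold>\<or> y) = x"
    and join_meet_absorb_right: "(y \<^bold>\<or> x) \<^bold>\<and> x = x"
    and join_meet_absorb: "x \<^bold>\<or> (x \<^bold>\<and> y) = x"
    and meet_join_absorb_right: "(y \<^bold>\<and> x) \<^bold>\<or> x = x"

text \<open>Green's relations are taken with respect to \<open>\<and>\<close>, also where the dual identities for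
  \<open>\<or>\<close> are concerned.\<close>

definition green_L :: "('a \<Rightarrow> 'a \<Rightarrow> 'a) \<Rightarrow> 'a \<Rightarrow> 'a \<Rightarrow> bool" where
  "green_L meet x y \<longleftrightarrow> meet x y = x \<and> meet y x = y"

definition green_R :: "('a \<Rightarrow> 'a \<Rightarrow> 'a) \<Rightarrow> 'a \<Rightarrow> 'a \<Rightarrow> bool" where
  "green_R meet x y \<longleftrightarrow> meet x y = y \<and> meet y x = x"

definition green_D :: "('a \<Rightarrow> 'a \<Rightarrow> 'a) \<Rightarrow> ('a \<times> 'a) set" where
  "green_D meet = {(x, y). meet (meet x y) x = x \<and> meet (meet y x) y = y}"

definition left_quasi_normal :: "('a \<Rightarrow> 'a \<Rightarrow> 'a) \<Rightarrow> bool" where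
  "left_quasi_normal meet \<longleftrightarrow>
    (\<forall>a x y. meet (meet a x) y = meet (meet (meet a x) a) y)"

definition right_quasi_normal :: "('a \<Rightarrow> 'a \<Rightarrow> 'a) \<Rightarrow> bool" where
  "right_quasi_normal meet \<longleftrightarrow>
    (\<forall>a x y. meet (meet y x) a = meet (meet (meet y a) x) a)"

abbreviation D_classes :: "('a \<Rightarrow> 'a \<Rightarrow> 'a) \<Rightarrow> 'a set set" where
  "D_classes meet \<equiv> UNIV // green_D meet"

definition class_meet :: "('a \<Rightarrow> 'a \<Rightarrow> 'a) \<Rightarrow> 'a set \<Rightarrow> 'a set \<Rightarrow> 'a set" where
  "class_meet meet A B = (\<Union>a\<in>A. \<Union>b\<in>B. green_D meet `` {meet a b})"

text \<open>\<open>A > B\<close> in the lattice \<open>S/D\<close>, whose order is given by \<open>B \<le> A \<longleftrightarrow> A \<and> B = B\<close>.\<close>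

definition class_greater :: "('a \<Rightarrow> 'a \<Rightarrow> 'a) \<Rightarrow> 'a set \<Rightarrow> 'a set \<Rightarrow> bool" where
  "class_greater meet A B \<longleftrightarrow>
    A \<in> D_classes meet \<and> B \<in> D_classes meet \<and> class_meet meet A B = B \<and> A \<noteq> B"

context skew_lattice
begin

lemma meet_factor:
  assumes x: "x = p \<^bold>\<and> z \<^bold>\<and> q"
  shows "x \<^bold>\<and> z \<^bold>\<and> x = x"
proof -
  have "(z \<^bold>\<and> q) \<^bold>\<and> (z \<^bold>\<and> q) = z \<^bold>\<and> q" by (rule meet_idem)
  then have 1: "x \<^bold>\<and> z \<^bold>\<and> q = x" using x by (simp add: meet.assoc)
  have "x \<^bold>\<and> z \<^bold>\<and> x = (x \<^bold>\<and> z) \<^bold>\<and> (x \<^bold>\<and> z) \<^bold>\<and> q"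
    by (subst (2) 1[symmetric]) (simp add: meet.assoc)
  also have "\<dots> = x" by (simp only: meet_idem 1)
  finally show ?thesis .
qed

lemma equiv_green_D: "equiv UNIV (green_D (\<^bold>\<and>))"
proof (rule equivI)
  show "refl (green_D (\<^bold>\<and>))" by (auto simp: refl_on_def green_D_def meet_idem)
  show "sym (green_D (\<^bold>\<and>))" by (auto simp: sym_def green_D_def)
  have "x \<^bold>\<and> z \<^bold>\<and> x = x"
    if "x \<^bold>\<and> y \<^bold>\<and> x = x" "y \<^bold>\<and> z \<^bold>\<and> y = y" for x y z
    by (rule meet_factor[where p = "x \<^bold>\<and> y" and q = "y \<^bold>\<and> x"]) (metis that meet.assoc)
  then show "trans (green_D (\<^bold>\<and>))" unfolding trans_def green_D_def by blast
qed auto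

lemma meet_insert: "y \<^bold>\<and> x \<^bold>\<and> z = (y \<^bold>\<and> x \<^bold>\<and> z) \<^bold>\<and> (y \<^bold>\<and> z) \<^bold>\<and> (y \<^bold>\<and> x \<^bold>\<and> z)"
proof -
  have "y \<^bold>\<and> x \<^bold>\<and> z = (y \<^bold>\<and> x) \<^bold>\<and> (z \<^bold>\<and> y) \<^bold>\<and> (x \<^bold>\<and> z)"
    using meet_idem[of "y \<^bold>\<and> x \<^bold>\<and> z"] by (simp add: meet.assoc)
  also have "\<dots> = (y \<^bold>\<and> x) \<^bold>\<and> ((z \<^bold>\<and> y) \<^bold>\<and> (z \<^bold>\<and> y)) \<^bold>\<and> (x \<^bold>\<and> z)"
    by (simp only: meet_idem)
  finally show ?thesis by (simp add: meet.assoc)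
qed

lemma congruent2_meet:
  "congruent2 (green_D (\<^bold>\<and>)) (green_D (\<^bold>\<and>)) (\<lambda>a b. green_D (\<^bold>\<and>) `` {a \<^bold>\<and> b})"
proof -
  have l: "(x \<^bold>\<and> z) \<^bold>\<and> (y \<^bold>\<and> z) \<^bold>\<and> (x \<^bold>\<and> z) = x \<^bold>\<and> z"
    if "x \<^bold>\<and> y \<^bold>\<and> x = x" for x y z
    by (rule meet_factor[where p = "x \<^bold>\<and> y \<^bold>\<and> x \<^bold>\<and> z" and q = "y \<^bold>\<and> x \<^bold>\<and> z"])
      (metis that meet_insert[of y x z] meet.assoc)
  have r: "(z \<^bold>\<and> x) \<^bold>\<and> (z \<^bold>\<and> y) \<^bold>\<and> (z \<^bold>\<and> x) = z \<^bold>\<and> x"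
    if "x \<^bold>\<and> y \<^bold>\<and> x = x" for x y z
    by (rule meet_factor[where p = "z \<^bold>\<and> x \<^bold>\<and> y" and q = "z \<^bold>\<and> x \<^bold>\<and> y \<^bold>\<and> x"])
      (metis that meet_insert[of z x y] meet.assoc)
  show ?thesis
    by (rule congruent2I[OF equiv_green_D equiv_green_D];
        rule equiv_class_eq[OF equiv_green_D]) (auto simp: green_D_def l r)
qed

lemma class_meet_classes:
  "class_meet (\<^bold>\<and>) (green_D (\<^bold>\<and>) `` {a}) (green_D (\<^bold>\<and>) `` {b}) = green_D (\<^bold>\<and>) `` {a \<^bold>\<and> b}"
  unfolding class_meet_def
  by (rule UN_equiv_class2[OF equiv_green_D equiv_green_D congruent2_meet]) simp_all

end

end

theory Submission
  imports Defs
begin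

text \<open>Both reducts of a skew lattice are regular bands, \<open>x \<and> y \<and> x \<and> z \<and> x = x \<and> y \<and> z \<and> x\<close>.
  Hence \<open>a \<and> x \<and> y\<close> and \<open>a \<and> x \<and> a \<and> y\<close> are always \<open>R\<close>-related and unchanged by \<open>\<and> y\<close>;
  if \<open>A\<close> is the class of \<open>y\<close> and \<open>u \<and> A = u' \<and> A\<close> for the two terms \<open>u, u'\<close>, then \<open>u = u' \<and> c\<close>
  for some \<open>c \<in> A\<close>, and \<open>u = u \<and> y = u' \<and> y \<and> c \<and> y = u' \<and> y = u'\<close>. Conversely, for \<open>x R x'\<close>,
  left quasi-normality gives \<open>x \<and> a = x' \<and> x \<and> a = x' \<and> x \<and> x' \<and> a = x' \<and> a\<close> outright.
  The other three equivalences are the images of this one under reversing the operations and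
  exchanging them.\<close>

context skew_lattice
begin

text \<open>Not every band is regular; here the join supplies \<open>v\<close>, R-related to
  \<open>x\<close> and a right unit for \<open>x \<and> y\<close>, and \<open>w\<close>, L-related
  to \<open>x\<close> and a left unit for \<open>z \<and> x\<close>.\<close>

lemma meet_regular: "x \<^bold>\<and> y \<^bold>\<and> x \<^bold>\<and> z \<^bold>\<and> x = x \<^bold>\<and> y \<^bold>\<and> z \<^bold>\<and> x"
proof -
  \<comment> \<open>\<open>v\<close> and \<open>w\<close> lie in the \<open>D\<close>-class of \<open>x\<close>, a rectangular band, so \<open>x\<close> may be inserted
    between them.\<close>
  define v where "v = (x \<^bold>\<and> y) \<^bold>\<or> x"
  define w where "w = x \<^bold>\<or> (z \<^bold>\<and> x)"
  have 1: "(x \<^bold>\<and> y) \<^bold>\<and> v = x \<^bold>\<and> y" "w \<^bold>\<and> (z \<^bold>\<and> x) = z \<^bold>\<and> x"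
    by (simp_all add: v_def w_def meet_join_absorb join_meet_absorb_right)
  have vx: "v \<^bold>\<and> x = x" "x \<^bold>\<and> w = x"
    by (simp_all add: v_def w_def meet_join_absorb join_meet_absorb_right)
  have "x \<^bold>\<or> v = x" "w \<^bold>\<or> x = x"
    unfolding v_def w_def
    by (simp_all add: join.assoc[symmetric] join_meet_absorb join_idem)
      (simp add: join.assoc meet_join_absorb_right join_idem)
  then have xv: "x \<^bold>\<and> v = v" "w \<^bold>\<and> x = w"
    using join_meet_absorb_right[of x v] meet_join_absorb[of w x] by simp_all
  have "w \<^bold>\<and> v \<^bold>\<and> w = w" "v \<^bold>\<and> w \<^bold>\<and> v = v"
    using vx xv meet_idem meet.assoc by (metis, metis)
  then have vw: "v \<^bold>\<and> w = x"
    using vx xv meet.assoc by metis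
  have "x \<^bold>\<and> y \<^bold>\<and> z \<^bold>\<and> x = (x \<^bold>\<and> y) \<^bold>\<and> (v \<^bold>\<and> w) \<^bold>\<and> (z \<^bold>\<and> x)"
    using 1 meet.assoc by metis
  also have "\<dots> = x \<^bold>\<and> y \<^bold>\<and> x \<^bold>\<and> z \<^bold>\<and> x"
    by (simp add: vw meet.assoc)
  finally show ?thesis ..
qed

lemma class_greater_iff:
  "class_greater (\<^bold>\<and>) A B \<longleftrightarrow>
    (\<exists>a b. A = green_D (\<^bold>\<and>) `` {a} \<and> B = green_D (\<^bold>\<and>) `` {b} \<and>
      b \<^bold>\<and> a \<^bold>\<and> b = b \<and> a \<^bold>\<and> b \<^bold>\<and> a \<noteq> a)"
proof -
  have "green_D (\<^bold>\<and>) `` {a \<^bold>\<and> b} = green_D (\<^bold>\<and>) `` {b} \<and> green_D (\<^bold>\<and>) `` {a} \<noteq> green_D (\<^bold>\<and>) `` {b}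
      \<longleftrightarrow> b \<^bold>\<and> a \<^bold>\<and> b = b \<and> a \<^bold>\<and> b \<^bold>\<and> a \<noteq> a" for a b
  proof -
    \<comment> \<open>One half of \<open>a \<and> b\<close> D \<open>b\<close> always holds and the
      other is \<open>b \<and> a \<and> b = b\<close>. Given this, \<open>a\<close> and
      \<open>b\<close> can only fail to be D-related through
      \<open>a \<and> b \<and> a \<noteq> a\<close>.\<close>
    have "b \<^bold>\<and> (a \<^bold>\<and> b) \<^bold>\<and> b = b \<^bold>\<and> a \<^bold>\<and> b" "(a \<^bold>\<and> b) \<^bold>\<and> b \<^bold>\<and> (a \<^bold>\<and> b) = a \<^bold>\<and> b"
      using meet_idem meet.assoc by metis+
    then show ?thesis
      unfolding eq_equiv_class_iff[OF equiv_green_D UNIV_I UNIV_I] by (auto simp: green_D_def)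
  qed
  then show ?thesis
    unfolding class_greater_def quotient_def
    by (auto simp: class_meet_classes) blast+
qed

lemma left_quasi_normal_iff_cosets:
  "left_quasi_normal (\<^bold>\<and>) \<longleftrightarrow>
    (\<forall>A B. class_greater (\<^bold>\<and>) A B \<longrightarrow>
      (\<forall>x\<in>B. \<forall>x'\<in>B. green_R (\<^bold>\<and>) x x' \<longrightarrow> {x \<^bold>\<and> a | a. a \<in> A} = {x' \<^bold>\<and> a | a. a \<in> A}))"
  (is "_ \<longleftrightarrow> ?cosets")
proof
  assume "left_quasi_normal (\<^bold>\<and>)"
  then have lqn: "a \<^bold>\<and> x \<^bold>\<and> y = a \<^bold>\<and> x \<^bold>\<and> a \<^bold>\<and> y" for a x y
    unfolding left_quasi_normal_def by blast
  have "x \<^bold>\<and> a = x' \<^bold>\<and> a" if "green_R (\<^bold>\<and>) x x'" for x x' a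
    using lqn[of x' x a] that by (simp add: green_R_def meet_idem)
  then show ?cosets by force
next
  assume cosets: ?cosets
  show "left_quasi_normal (\<^bold>\<and>)"
    unfolding left_quasi_normal_def
  proof (intro allI)
    fix a x y
    define u where "u = a \<^bold>\<and> x \<^bold>\<and> y"
    define u' where "u' = a \<^bold>\<and> x \<^bold>\<and> a \<^bold>\<and> y"
    have uy: "u \<^bold>\<and> y = u" "u' \<^bold>\<and> y = u'"
      unfolding u_def u'_def by (simp_all add: meet.assoc meet_idem)
    \<comment> \<open>The aim is \<open>u' = u \<and> a \<and> y\<close>, from which
      \<open>u \<and> u' = u'\<close> follows. Regularity first puts a \<open>y\<close> between
      \<open>x\<close> and \<open>a\<close>, then drops the \<open>a\<close> in front of
      \<open>y \<and> x \<and> y\<close>.\<close>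
    have "u' = a \<^bold>\<and> x \<^bold>\<and> a \<^bold>\<and> (y \<^bold>\<and> x \<^bold>\<and> a \<^bold>\<and> y)"
      unfolding u'_def using meet_idem[of "x \<^bold>\<and> a \<^bold>\<and> y"] by (simp add: meet.assoc)
    also have "\<dots> = a \<^bold>\<and> x \<^bold>\<and> a \<^bold>\<and> (y \<^bold>\<and> x \<^bold>\<and> y \<^bold>\<and> a \<^bold>\<and> y)"
      by (simp only: meet_regular)
    also have "\<dots> = (a \<^bold>\<and> x \<^bold>\<and> a \<^bold>\<and> (y \<^bold>\<and> x \<^bold>\<and> y) \<^bold>\<and> a) \<^bold>\<and> y"
      by (simp add: meet.assoc)
    also have "\<dots> = a \<^bold>\<and> x \<^bold>\<and> (y \<^bold>\<and> x \<^bold>\<and> y) \<^bold>\<and> a \<^bold>\<and> y"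
      by (simp only: meet_regular)
    finally have u': "u' = a \<^bold>\<and> (x \<^bold>\<and> y) \<^bold>\<and> a \<^bold>\<and> y"
      by (metis meet.assoc meet_idem)
    have "u \<^bold>\<and> u' = (u \<^bold>\<and> u) \<^bold>\<and> a \<^bold>\<and> y"
      unfolding u' u_def by (simp add: meet.assoc)
    then have uu': "u \<^bold>\<and> u' = u'"
      unfolding meet_idem u' u_def by (simp add: meet.assoc)
    have "u' \<^bold>\<and> u = (a \<^bold>\<and> x \<^bold>\<and> a \<^bold>\<and> y \<^bold>\<and> a) \<^bold>\<and> (x \<^bold>\<and> y)"
      unfolding u'_def u_def by (simp add: meet.assoc)
    also have "\<dots> = u \<^bold>\<and> u"
      unfolding meet_regular u_def by (simp add: meet.assoc)
    finally have u'u: "u' \<^bold>\<and> u = u"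
      by (simp add: meet_idem)
    have "u = u'"
    \<comment> \<open>The coset condition covers only strictly comparable classes, so
      \<open>y\<close> D \<open>u\<close> is treated apart: there \<open>u'\<close> is a factor of
      \<open>y\<close>, hence \<open>y \<and> u' = y\<close> and
      \<open>u = u \<and> y \<and> u' = u'\<close>.\<close>
    proof (cases "y \<^bold>\<and> u \<^bold>\<and> y = y")
      case True
      then have "y = y \<^bold>\<and> u' \<^bold>\<and> u"
        using uy(1) u'u by (simp add: meet.assoc)
      from meet_factor[OF this] have "y \<^bold>\<and> u' = y"
        using uy(2) by (simp add: meet.assoc)
      then show ?thesis
        using uy(1) uu' by (metis meet.assoc)
    next
      case False
      define A where "A = green_D (\<^bold>\<and>) `` {y}"
      define B where "B = green_D (\<^bold>\<and>) `` {u}"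
      have "class_greater (\<^bold>\<and>) A B"
        unfolding class_greater_iff A_def B_def
        by (intro exI[of _ y] exI[of _ u]) (simp add: False uy(1) meet_idem)
      moreover have "u \<in> B" "u' \<in> B"
        using uu' u'u by (simp_all add: B_def green_D_def meet_idem)
      moreover have "green_R (\<^bold>\<and>) u u'"
        using uu' u'u by (simp add: green_R_def)
      ultimately have "{u \<^bold>\<and> c | c. c \<in> A} = {u' \<^bold>\<and> c | c. c \<in> A}"
        using cosets by blast
      moreover have "y \<in> A"
        by (simp add: A_def green_D_def meet_idem)
      then have "u \<in> {u \<^bold>\<and> c | c. c \<in> A}"
        using uy(1)[symmetric] by (intro CollectI exI[of _ y] conjI)
      ultimately have "u \<in> {u' \<^bold>\<and> c | c. c \<in> A}"
        by (rule subst)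
      then obtain c where c: "c \<in> A" "u = u' \<^bold>\<and> c"
        by (elim CollectE exE conjE)
      have "u = u' \<^bold>\<and> (y \<^bold>\<and> c \<^bold>\<and> y)"
        using c(2) uy by (metis meet.assoc)
      also have "y \<^bold>\<and> c \<^bold>\<and> y = y"
        using c(1) by (simp add: A_def green_D_def)
      finally show ?thesis using uy(2) by simp
    qed
    then show "a \<^bold>\<and> x \<^bold>\<and> y = a \<^bold>\<and> x \<^bold>\<and> a \<^bold>\<and> y" by (simp only: u_def u'_def)
  qed
qed

lemma skew_lattice_reverse: "skew_lattice (\<lambda>x y. y \<^bold>\<and> x) (\<lambda>x y. y \<^bold>\<or> x)"
  by unfold_locales
    (simp_all add: meet.assoc join.assoc meet_idem join_idem meet_join_absorb
      join_meet_absorb_right join_meet_absorb meet_join_absorb_right)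

lemma skew_lattice_swap: "skew_lattice (\<^bold>\<or>) (\<^bold>\<and>)"
  by unfold_locales
    (simp_all add: meet_idem join_idem meet_join_absorb
      join_meet_absorb_right join_meet_absorb meet_join_absorb_right)

text \<open>\<open>class_meet\<close> depends on the order of the factors, but
  \<open>green_D\<close> and the description by representatives involve only palindromes.\<close>

lemma class_greater_reverse: "class_greater (\<lambda>x y. y \<^bold>\<and> x) = class_greater (\<^bold>\<and>)"
proof (intro ext)
  fix A B
  have "green_D (\<lambda>x y. y \<^bold>\<and> x) = green_D (\<^bold>\<and>)"
    by (simp add: green_D_def meet.assoc)
  then show "class_greater (\<lambda>x y. y \<^bold>\<and> x) A B = class_greater (\<^bold>\<and>) A B"
    unfolding class_greater_iff skew_lattice.class_greater_iff[OF skew_lattice_reverse]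
    by (simp add: meet.assoc)
qed

lemma right_quasi_normal_iff_cosets:
  "right_quasi_normal (\<^bold>\<and>) \<longleftrightarrow>
    (\<forall>A B. class_greater (\<^bold>\<and>) A B \<longrightarrow>
      (\<forall>x\<in>B. \<forall>x'\<in>B. green_L (\<^bold>\<and>) x x' \<longrightarrow> {a \<^bold>\<and> x | a. a \<in> A} = {a \<^bold>\<and> x' | a. a \<in> A}))"
proof -
  have "right_quasi_normal (\<^bold>\<and>) = left_quasi_normal (\<lambda>x y. y \<^bold>\<and> x)"
    unfolding right_quasi_normal_def left_quasi_normal_def by (simp add: meet.assoc)
  moreover have "green_R (\<lambda>x y. y \<^bold>\<and> x) = green_L (\<^bold>\<and>)"
    by (auto simp: green_R_def green_L_def fun_eq_iff)
  ultimately show ?thesis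
    unfolding skew_lattice.left_quasi_normal_iff_cosets[OF skew_lattice_reverse]
      class_greater_reverse by simp
qed

text \<open>By absorption, this and the next equivalence turn Green's relations of one operation
  into those of the other, with L and R exchanged.\<close>

lemma join_eq_right_iff: "x \<^bold>\<or> y = y \<longleftrightarrow> x \<^bold>\<and> y = x"
  by (metis meet_join_absorb meet_join_absorb_right)

lemma join_eq_left_iff: "x \<^bold>\<or> y = x \<longleftrightarrow> x \<^bold>\<and> y = y"
  by (metis join_meet_absorb join_meet_absorb_right)

lemma green_R_join: "green_R (\<^bold>\<or>) = green_L (\<^bold>\<and>)"
  by (auto simp: green_R_def green_L_def join_eq_right_iff fun_eq_iff)

lemma green_L_join: "green_L (\<^bold>\<or>) = green_R (\<^bold>\<and>)"
  by (auto simp: green_R_def green_L_def join_eq_left_iff fun_eq_iff)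

text \<open>Absorption writes \<open>x\<close> as a join with \<open>y\<close> among its factors, so
  \<open>meet_factor\<close> applies to the exchanged operations.\<close>

lemma join_sandwich:
  assumes "y \<^bold>\<and> x \<^bold>\<and> y = y"
  shows "x \<^bold>\<or> y \<^bold>\<or> x = x"
proof (rule skew_lattice.meet_factor[OF skew_lattice_swap])
  have "y \<^bold>\<or> (x \<^bold>\<and> y) = x \<^bold>\<and> y"
    using assms by (simp add: join_eq_right_iff meet.assoc)
  then show "x = x \<^bold>\<or> y \<^bold>\<or> (x \<^bold>\<and> y)"
    by (simp add: join.assoc join_meet_absorb)
qed

text \<open>Since \<open>x\<close> and \<open>y\<close> trade places, both operations have the same
  D-classes but opposite orders on them.\<close>

lemma join_sandwich_iff: "x \<^bold>\<or> y \<^bold>\<or> x = x \<longleftrightarrow> y \<^bold>\<and> x \<^bold>\<and> y = y"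
  using join_sandwich skew_lattice.join_sandwich[OF skew_lattice_swap] by blast

lemma green_D_join: "green_D (\<^bold>\<or>) = green_D (\<^bold>\<and>)"
  by (auto simp: green_D_def join_sandwich_iff)

lemma class_greater_join: "class_greater (\<^bold>\<or>) A B = class_greater (\<^bold>\<and>) B A"
  unfolding class_greater_iff skew_lattice.class_greater_iff[OF skew_lattice_swap]
    green_D_join join_sandwich_iff by blast

end

theorem proposition3p6:
  fixes meet :: "'a \<Rightarrow> 'a \<Rightarrow> 'a" (infixl "\<^bold>\<and>" 70)
    and join :: "'a \<Rightarrow> 'a \<Rightarrow> 'a" (infixl "\<^bold>\<or>" 65)
  assumes "skew_lattice (\<^bold>\<and>) (\<^bold>\<or>)"
  shows "(left_quasi_normal (\<^bold>\<and>) \<longleftrightarrow>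
      (\<forall>A B. class_greater (\<^bold>\<and>) A B \<longrightarrow>
        (\<forall>x\<in>B. \<forall>x'\<in>B. green_R (\<^bold>\<and>) x x' \<longrightarrow> {x \<^bold>\<and> a | a. a \<in> A} = {x' \<^bold>\<and> a | a. a \<in> A}))) \<and>
    (right_quasi_normal (\<^bold>\<and>) \<longleftrightarrow>
      (\<forall>A B. class_greater (\<^bold>\<and>) A B \<longrightarrow>
        (\<forall>x\<in>B. \<forall>x'\<in>B. green_L (\<^bold>\<and>) x x' \<longrightarrow> {a \<^bold>\<and> x | a. a \<in> A} = {a \<^bold>\<and> x' | a. a \<in> A}))) \<and>
    ((\<forall>a x y. a \<^bold>\<or> x \<^bold>\<or> y = a \<^bold>\<or> x \<^bold>\<or> a \<^bold>\<or> y) \<longleftrightarrow>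
      (\<forall>A B. class_greater (\<^bold>\<and>) A B \<longrightarrow>
        (\<forall>x\<in>A. \<forall>x'\<in>A. green_L (\<^bold>\<and>) x x' \<longrightarrow> {x \<^bold>\<or> b | b. b \<in> B} = {x' \<^bold>\<or> b | b. b \<in> B}))) \<and>
    ((\<forall>a x y. y \<^bold>\<or> x \<^bold>\<or> a = y \<^bold>\<or> a \<^bold>\<or> x \<^bold>\<or> a) \<longleftrightarrow>
      (\<forall>A B. class_greater (\<^bold>\<and>) A B \<longrightarrow>
        (\<forall>x\<in>A. \<forall>x'\<in>A. green_R (\<^bold>\<and>) x x' \<longrightarrow> {b \<^bold>\<or> x | b. b \<in> B} = {b \<^bold>\<or> x' | b. b \<in> B})))"
proof -
  interpret skew_lattice "(\<^bold>\<and>)" "(\<^bold>\<or>)" by (fact assms)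
  note swap = skew_lattice_swap
  have "(\<forall>a x y. a \<^bold>\<or> x \<^bold>\<or> y = a \<^bold>\<or> x \<^bold>\<or> a \<^bold>\<or> y) \<longleftrightarrow>
      (\<forall>A B. class_greater (\<^bold>\<and>) A B \<longrightarrow>
        (\<forall>x\<in>A. \<forall>x'\<in>A. green_L (\<^bold>\<and>) x x' \<longrightarrow> {x \<^bold>\<or> b | b. b \<in> B} = {x' \<^bold>\<or> b | b. b \<in> B}))"
    \<comment> \<open>The reversed order makes \<open>A\<close> and \<open>B\<close> trade roles;
      \<open>all_comm\<close> realigns their quantifiers.\<close>
    using skew_lattice.left_quasi_normal_iff_cosets[OF swap]
    unfolding left_quasi_normal_def green_R_join class_greater_join by (subst all_comm)
  moreover have "(\<forall>a x y. y \<^bold>\<or> x \<^bold>\<or> a = y \<^bold>\<or> a \<^bold>\<or> x \<^bold>\<or> a) \<longleftrightarrow>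
      (\<forall>A B. class_greater (\<^bold>\<and>) A B \<longrightarrow>
        (\<forall>x\<in>A. \<forall>x'\<in>A. green_R (\<^bold>\<and>) x x' \<longrightarrow> {b \<^bold>\<or> x | b. b \<in> B} = {b \<^bold>\<or> x' | b. b \<in> B}))"
    using skew_lattice.right_quasi_normal_iff_cosets[OF swap]
    unfolding right_quasi_normal_def green_L_join class_greater_join by (subst all_comm)
  ultimately show ?thesis
    using left_quasi_normal_iff_cosets right_quasi_normal_iff_cosets by (intro conjI)
qed

end
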